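(* Let $X$ be a complex normed space, let $k\ge 2$, and let $\mathcal{C}=\{P_1,P_2,\ldots,P_k\}$ be a family of $k$-circular idempotents on $X$. Then each $P_i$ is continuous, $1\le i\le k$.
   Context: A map $P:X\to X$ is called idempotent if $P^2=P\circ P=P$; no linearity or continuity is assumed. Products of maps denote composition, sums and scalar multiples of maps are pointwise, $I$ is the identity map, $0$ the zero map, and $\mathbb{T}=\{\lambda\in\mathbb{C}:|\lambda|=1\}$. An isometry on $X$ is a map $T:X\to X$ (not necessarily linear) with $\|Tx-Ty\|=\|x-y\|$ for all $x,y\in X$. A finite collection $\{P_1,\ldots,P_k\}$, $k\ge2$, of nonzero, pairwise distinct idempotent maps on $X$ is an orthogonal partition of the identity by idempotents if $\sum_{i=1}^k P_i=I$ and $P_iP_j=0$ for all $i\neq j$. Such an orthogonal partition of the identity by idempotents is called a family of $k$-circular idempotents if $\sum_{i=1}^k\lambda_iP_i$ is a surjective isometry on $X$ for all $\lambda_1,\ldots,\lambda_k\in\mathbb{T}$. *)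

theory Defs
  imports "HOL-Analysis.Analysis"
begin

text \<open>
  A complex normed space (not assumed complete) is a real normed space whose real scalar
  multiplication is the restriction of a complex one, for which the norm is absolutely
  homogeneous.
\<close>

class complex_normed_vector = real_normed_vector +
  fixes scaleC :: "complex \<Rightarrow> 'a \<Rightarrow> 'a" (infixr \<open>*\<^sub>C\<close> 75)
  assumes scaleC_add_right: "a *\<^sub>C (x + y) = a *\<^sub>C x + a *\<^sub>C y"
    and scaleC_add_left: "(a + b) *\<^sub>C x = a *\<^sub>C x + b *\<^sub>C x"
    and scaleC_scaleC: "a *\<^sub>C (b *\<^sub>C x) = (a * b) *\<^sub>C x"
    and scaleC_of_real: "complex_of_real r *\<^sub>C x = r *\<^sub>R x"
    and norm_scaleC: "norm (a *\<^sub>C x) = cmod a * norm x"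

instantiation complex :: complex_normed_vector
begin

definition "scaleC = ((*) :: complex \<Rightarrow> complex \<Rightarrow> complex)"

instance
  by standard (simp_all add: scaleC_complex_def algebra_simps norm_mult scaleR_conv_of_real)

end

definition idempotent_map :: "('a \<Rightarrow> 'a) \<Rightarrow> bool" where
  "idempotent_map P \<longleftrightarrow> P \<circ> P = P"

text \<open>Isometries are not assumed to be linear or surjective.\<close>

definition isometry_map :: "('a::real_normed_vector \<Rightarrow> 'a) \<Rightarrow> bool" where
  "isometry_map T \<longleftrightarrow> (\<forall>x y. norm (T x - T y) = norm (x - y))"

definition orthogonal_partition :: "nat \<Rightarrow> (nat \<Rightarrow> 'a::real_normed_vector \<Rightarrow> 'a) \<Rightarrow> bool" where
  "orthogonal_partition k P \<longleftrightarrow>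
     2 \<le> k \<and>
     (\<forall>i\<in>{1..k}. idempotent_map (P i) \<and> P i \<noteq> (\<lambda>x. 0)) \<and>
     inj_on P {1..k} \<and>
     (\<lambda>x. \<Sum>i=1..k. P i x) = id \<and>
     (\<forall>i\<in>{1..k}. \<forall>j\<in>{1..k}. i \<noteq> j \<longrightarrow> P i \<circ> P j = (\<lambda>x. 0))"

definition circular_idempotents ::
    "nat \<Rightarrow> (nat \<Rightarrow> 'a::complex_normed_vector \<Rightarrow> 'a) \<Rightarrow> bool" where
  "circular_idempotents k P \<longleftrightarrow>
     orthogonal_partition k P \<and>
     (\<forall>c :: nat \<Rightarrow> complex. (\<forall>i\<in>{1..k}. cmod (c i) = 1) \<longrightarrow>
        isometry_map (\<lambda>x. \<Sum>i=1..k. c i *\<^sub>C P i x) \<and>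
        surj (\<lambda>x. \<Sum>i=1..k. c i *\<^sub>C P i x))"

end

theory Submission
  imports Defs
begin

text \<open>
  Changing the sign of a single coefficient isolates a single idempotent: with \<open>\<lambda>\<^sub>i = -1\<close> and all
  other \<open>\<lambda>\<^sub>j = 1\<close>, the combination \<open>\<Sum>\<^sub>j \<lambda>\<^sub>j P\<^sub>j\<close> equals \<open>I - 2 P\<^sub>i\<close> because \<open>\<Sum>\<^sub>j P\<^sub>j = I\<close>. This map \<open>T\<close> is
  an isometry, so \<open>P\<^sub>i = (I - T) / 2\<close> is half the difference of two isometries. By the triangle
  inequality \<open>P\<^sub>i\<close> does not increase distances, and in particular it is continuous.
\<close>

lemma isometry_map_reflection:
  fixes P :: "nat \<Rightarrow> 'a::complex_normed_vector \<Rightarrow> 'a"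
  assumes circ: "circular_idempotents k P" and i: "i \<in> {1..k}"
  shows "isometry_map (\<lambda>x. x - 2 *\<^sub>R P i x)"
proof -
  define c :: "nat \<Rightarrow> complex" where "c j = (if j = i then -1 else 1)" for j
  have term_eq: "c j *\<^sub>C P j x = P j x - (if j = i then 2 *\<^sub>R P j x else 0)" for j x
    using scaleC_of_real[of "-1" "P j x"] scaleC_of_real[of 1 "P j x"]
    by (auto simp: c_def scaleR_2)
  have "(\<Sum>j=1..k. c j *\<^sub>C P j x) = x - 2 *\<^sub>R P i x" for x
  proof -
    have "(\<Sum>j=1..k. P j x) = x"
      using circ unfolding circular_idempotents_def orthogonal_partition_def
      by (metis (mono_tags, lifting) id_apply)
    then show ?thesis
      using i by (simp add: term_eq sum_subtractf)
  qed
  moreover have "isometry_map (\<lambda>x. \<Sum>j=1..k. c j *\<^sub>C P j x)"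
    using circ by (simp add: circular_idempotents_def c_def)
  ultimately show ?thesis
    by simp
qed

lemma nonexpansive_if_reflection_isometry:
  fixes Q :: "'a::real_normed_vector \<Rightarrow> 'a"
  assumes "isometry_map (\<lambda>x. x - 2 *\<^sub>R Q x)"
  shows "1-lipschitz_on UNIV Q"
proof (rule lipschitz_onI)
  fix x y
  let ?T = "\<lambda>x. x - 2 *\<^sub>R Q x"
  have "2 * norm (Q x - Q y) = norm ((x - y) - (?T x - ?T y))"
    by (simp add: algebra_simps flip: scaleR_diff_right)
  also have "\<dots> \<le> norm (x - y) + norm (?T x - ?T y)"
    by (rule norm_triangle_ineq4)
  also have "\<dots> = 2 * norm (x - y)"
    using assms by (simp add: isometry_map_def)
  finally show "dist (Q x) (Q y) \<le> 1 * dist x y"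
    by (simp add: dist_norm)
qed simp

theorem theoremB:
  fixes P :: "nat \<Rightarrow> 'a::complex_normed_vector \<Rightarrow> 'a" and k :: nat
  assumes "2 \<le> k"
    and "circular_idempotents k P"
  shows "\<forall>i\<in>{1..k}. continuous_on UNIV (P i)"
  using isometry_map_reflection[OF assms(2)]
  by (blast intro: lipschitz_on_continuous_on nonexpansive_if_reflection_isometry)

end
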